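(* ($F$-Internal Set Definition Principle.) Let $\phi(\overline{A},\overline{x},y)$ be an $\mathscr{L}^+$-formula with $n+1$ free variables $\overline{x},y$, where $\overline{A}$ is a tuple of internal predicates. Then for any $n$-tuple $\overline{a}$ of elements of ${}^\dagger\mathcal{R}$ and any $F\in\mathfrak{F}$, the set $\{b\in{}^\dagger\mathcal{R}:F\Vdash\phi(\overline{A},\overline{a},b)\}$ is an $F$-internal subset of ${}^\dagger\mathcal{R}$.
   Context: Background theory: ZF + Dependent Choices. The Fréchet filter $F_0$ is the filter of cofinite subsets of $\omega$; $\mathfrak{F}$ is the set of all proper filters on $\omega$ extending $F_0$. $\mathscr{L}$ is the first-order language (with equality) with a relation symbol for every finitary relation on $\mathbb{R}$ and a function symbol for every finitary function on $\mathbb{R}$; $\mathcal{R}$ is the $\mathscr{L}$-structure with domain $\mathbb{R}$ interpreting each symbol as the relation or function it corresponds to. $\mathscr{L}^+$ is $\mathscr{L}$ together with a unary predicate symbol $A$ (an internal predicate) for each sequence $\{A_i\}_{i\in\omega}$ of subsets of $\mathbb{R}$. The $F$-hyperreal line ${}^\dagger\mathcal{R}$ is the possibility structure with set of viewpoints $\mathfrak{F}$ (ordered by reverse inclusion) and domain $\mathbb{R}^\omega$ (so elements and subsets of ${}^\dagger\mathcal{R}$ are elements and subsets of $\mathbb{R}^\omega$), where function symbols are interpreted pointwise. For a tuple $\overline{a}=(a_1,\dots,a_n)$, $\overline{a}(i)=(a_1(i),\dots,a_n(i))$. The forcing relation $F\Vdash\phi(\overline{a})$ is defined inductively for $F\in\mathfrak{F}$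 by: - for $\phi$ an atomic $\mathscr{L}$-formula (including equations between terms, terms being evaluated pointwise): $F\Vdash\phi(\overline{a})$ iff $\{i\in\omega:\mathcal{R}\models\phi(\overline{a}(i))\}\in F$; for an internal predicate $A$ (and a term with pointwise value $a$): $F\Vdash A(a)$ iff $\{i\in\omega:a(i)\in A_i\}\in F$; - $F\Vdash\neg\psi$ iff for all $G\in\mathfrak{F}$ with $G\supseteq F$, $G\nVdash\psi$; - $F\Vdash\psi\wedge\chi$ iff $F\Vdash\psi$ and $F\Vdash\chi$; - $F\Vdash\psi\vee\chi$ iff for all $G\supseteq F$ in $\mathfrak{F}$ there is $H\supseteq G$ in $\mathfrak{F}$ with $H\Vdash\psi$ or $H\Vdash\chi$; - $F\Vdash\psi\to\chi$ iff for all $G\supseteq F$ in $\mathfrak{F}$, $G\Vdash\psi$ implies $G\Vdash\chi$; - $F\Vdash\forall x\psi$ iff $F\Vdash\psi(b)$ for all $b\in\mathbb{R}^\omega$; - $F\Vdash\exists x\psi$ iff for all $G\supseteq F$ in $\mathfrak{F}$ there are $H\supseteq G$ in $\mathfrak{F}$ and $b\in\mathbb{R}^\omega$ with $H\Vdash\psi(b)$. $F$-internal sets. For a sequence $\{A_n\}_{n\in\omega}$ of subsets of $\mathbb{R}$ and $F\in\mathfrak{F}$, let $A_F=\{a\in\mathbb{R}^\omega:\{i\in\omega:a(i)\in A_i\}\in F\}$. A subset $D\subseteq\mathbb{R}^\omega$ is $F$-internal if $D=A_F$ for some sequence $\{A_n\}_{n\in\omega}$ of subsets of $\mathbb{R}$.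 *)

theory Defs
  imports Complex_Main "HOL-Library.FuncSet"
begin

text \<open>
  Filters on \<open>\<omega>\<close> are the library's \<open>nat filter\<close>: \<open>{i. P i} \<in> F\<close> is \<open>eventually P F\<close>, the improper
  filter is \<open>bot\<close>, and \<open>cofinite\<close> is the Frechet filter. The library order is reverse inclusion, so
  \<open>G \<le> F\<close> says that \<open>G\<close> extends \<open>F\<close>.
\<close>

definition viewpoints :: "nat filter set" where
  "viewpoints = {F. F \<noteq> bot \<and> F \<le> cofinite}"

type_synonym hyper = "nat \<Rightarrow> real"

text \<open>
  A symbol is its arity together with the function or relation it names. Functions and relations
  on \<open>\<real>\<^sup>n\<close> live on the lists of length \<open>n\<close>; outside these lists a function is normalised to
  \<open>undefined\<close> so that every \<open>n\<close>-ary function is named by exactly one symbol.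
\<close>

definition function_symbol :: "nat \<Rightarrow> (real list \<Rightarrow> real) \<Rightarrow> bool" where
  "function_symbol n f \<longleftrightarrow> f \<in> extensional {xs. length xs = n}"

definition relation_symbol :: "nat \<Rightarrow> real list set \<Rightarrow> bool" where
  "relation_symbol n R \<longleftrightarrow> R \<subseteq> {xs. length xs = n}"

datatype tm =
    Var nat
  | Fn nat "real list \<Rightarrow> real" "tm list"

text \<open>The predicate symbol of a sequence of subsets of \<open>\<real>\<close> is the sequence itself.\<close>

datatype fm =
    Eq tm tm
  | Rel nat "real list set" "tm list"
  | Internal "nat \<Rightarrow> real set" tm
  | Neg fm
  | Conj fm fm
  | Disj fm fm
  | Imp fm fm
  | All nat fm
  | Ex nat fm

fun is_term :: "tm \<Rightarrow> bool" where
  "is_term (Var v) \<longleftrightarrow> True"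
| "is_term (Fn n f ts) \<longleftrightarrow> function_symbol n f \<and> length ts = n \<and> (\<forall>t\<in>set ts. is_term t)"

primrec is_formula :: "fm \<Rightarrow> bool" where
  "is_formula (Eq s t) \<longleftrightarrow> is_term s \<and> is_term t"
| "is_formula (Rel n R ts) \<longleftrightarrow> relation_symbol n R \<and> length ts = n \<and> (\<forall>t\<in>set ts. is_term t)"
| "is_formula (Internal A t) \<longleftrightarrow> is_term t"
| "is_formula (Neg p) \<longleftrightarrow> is_formula p"
| "is_formula (Conj p q) \<longleftrightarrow> is_formula p \<and> is_formula q"
| "is_formula (Disj p q) \<longleftrightarrow> is_formula p \<and> is_formula q"
| "is_formula (Imp p q) \<longleftrightarrow> is_formula p \<and> is_formula q"
| "is_formula (All v p) \<longleftrightarrow> is_formula p"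
| "is_formula (Ex v p) \<longleftrightarrow> is_formula p"

fun tm_vars :: "tm \<Rightarrow> nat set" where
  "tm_vars (Var v) = {v}"
| "tm_vars (Fn n f ts) = (\<Union>t\<in>set ts. tm_vars t)"

primrec free_vars :: "fm \<Rightarrow> nat set" where
  "free_vars (Eq s t) = tm_vars s \<union> tm_vars t"
| "free_vars (Rel n R ts) = (\<Union>t\<in>set ts. tm_vars t)"
| "free_vars (Internal A t) = tm_vars t"
| "free_vars (Neg p) = free_vars p"
| "free_vars (Conj p q) = free_vars p \<union> free_vars q"
| "free_vars (Disj p q) = free_vars p \<union> free_vars q"
| "free_vars (Imp p q) = free_vars p \<union> free_vars q"
| "free_vars (All v p) = free_vars p - {v}"
| "free_vars (Ex v p) = free_vars p - {v}"

primrec tm_val :: "(nat \<Rightarrow> real) \<Rightarrow> tm \<Rightarrow> real" where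
  "tm_val e (Var v) = e v"
| "tm_val e (Fn n f ts) = f (map (tm_val e) ts)"

text \<open>The pointwise value in \<open>\<real>\<^sup>\<omega>\<close> of a term under an assignment of elements of \<open>\<real>\<^sup>\<omega>\<close>.\<close>

definition hval :: "(nat \<Rightarrow> hyper) \<Rightarrow> tm \<Rightarrow> hyper" where
  "hval e t = (\<lambda>i. tm_val (\<lambda>v. e v i) t)"

lemma hval_Var [simp]: "hval e (Var v) = e v"
  by (simp add: hval_def)

lemma hval_Fn [simp]: "hval e (Fn n f ts) = (\<lambda>i. f (map (\<lambda>t. hval e t i) ts))"
  by (simp add: hval_def comp_def cong: map_cong)

primrec forces :: "fm \<Rightarrow> nat filter \<Rightarrow> (nat \<Rightarrow> hyper) \<Rightarrow> bool" where
  "forces (Eq s t) F e \<longleftrightarrow> (\<forall>\<^sub>F i in F. hval e s i = hval e t i)"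
| "forces (Rel n R ts) F e \<longleftrightarrow> (\<forall>\<^sub>F i in F. map (\<lambda>t. hval e t i) ts \<in> R)"
| "forces (Internal A t) F e \<longleftrightarrow> (\<forall>\<^sub>F i in F. hval e t i \<in> A i)"
| "forces (Neg p) F e \<longleftrightarrow> (\<forall>G\<in>viewpoints. G \<le> F \<longrightarrow> \<not> forces p G e)"
| "forces (Conj p q) F e \<longleftrightarrow> forces p F e \<and> forces q F e"
| "forces (Disj p q) F e \<longleftrightarrow>
     (\<forall>G\<in>viewpoints. G \<le> F \<longrightarrow> (\<exists>H\<in>viewpoints. H \<le> G \<and> (forces p H e \<or> forces q H e)))"
| "forces (Imp p q) F e \<longleftrightarrow> (\<forall>G\<in>viewpoints. G \<le> F \<longrightarrow> forces p G e \<longrightarrow> forces q G e)"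
| "forces (All v p) F e \<longleftrightarrow> (\<forall>b. forces p F (e(v := b)))"
| "forces (Ex v p) F e \<longleftrightarrow>
     (\<forall>G\<in>viewpoints. G \<le> F \<longrightarrow> (\<exists>H\<in>viewpoints. H \<le> G \<and> (\<exists>b. forces p H (e(v := b)))))"

text \<open>
  \<open>assign vs as\<close> sends the \<open>k\<close>-th variable of \<open>vs\<close> to the \<open>k\<close>-th entry of \<open>as\<close>. Its value at other
  variables is a dummy, irrelevant for formulas whose free variables are among \<open>vs\<close>.
\<close>

definition assign :: "nat list \<Rightarrow> hyper list \<Rightarrow> nat \<Rightarrow> hyper" where
  "assign vs as v = (case map_of (zip vs as) v of Some a \<Rightarrow> a | None \<Rightarrow> (\<lambda>i. 0))"

definition internal_ext :: "nat filter \<Rightarrow> (nat \<Rightarrow> real set) \<Rightarrow> hyper set" where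
  "internal_ext F A = {a. \<forall>\<^sub>F i in F. a i \<in> A i}"

definition internal_in :: "nat filter \<Rightarrow> hyper set \<Rightarrow> bool" where
  "internal_in F D \<longleftrightarrow> (\<exists>A. D = internal_ext F A)"

end

theory Submission
  imports Defs
begin

text \<open>
  A formula can be evaluated coordinate by coordinate: at \<open>i \<in> \<omega>\<close> read it classically in
  \<open>\<real>\<close>, with each internal predicate \<open>A\<close> standing for the set \<open>A\<^sub>i\<close>. The proof rests on an
  analogue of the theorem of Los, with ``for all viewpoints below'' playing the part that
  maximality of an ultrafilter plays classically: \<open>F\<close> forces a formula iff the set of coordinates
  at which it is classically true belongs to \<open>F\<close> (\<open>forces_iff_eventually_holds_at\<close>). Granting
  this, the set defined by \<open>\<phi>\<close> is \<open>A\<^sub>F\<close> for the sequence in which \<open>A\<^sub>i\<close> is the subset of \<open>\<real>\<close>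
  that \<open>\<phi>\<close> defines at coordinate \<open>i\<close>.

  The propositional connectives reduce to one observation: if \<open>{i. P i} \<notin> F\<close>, then \<open>F\<close> together
  with the complement of \<open>{i. P i}\<close> still generates a proper filter, that is, a viewpoint extending
  \<open>F\<close>. A failure of \<open>P\<close> modulo \<open>F\<close> is therefore always witnessed outright at some later viewpoint,
  and the clauses of forcing, which quantify over later viewpoints, pick this witness up.
  For the quantifiers, one chooses a real witness (or counterexample) at each coordinate; the
  resulting sequence is an element of \<open>\<real>\<^sup>\<omega>\<close> that serves at all coordinates simultaneously.
\<close>

section \<open>Membership in a filter and its extensions\<close>

text \<open>
  Adjoining the complement of \<open>P\<close> to \<open>F\<close> yields the improper filter only when \<open>P\<close> already
  belongs to \<open>F\<close>.
\<close>

lemma viewpoint_refuting: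
  assumes "F \<in> viewpoints" and "\<not> eventually P F"
  obtains G where "G \<in> viewpoints" and "G \<le> F" and "\<forall>\<^sub>F i in G. \<not> P i"
proof
  let ?G = "inf F (principal {i. \<not> P i})"
  show "?G \<in> viewpoints"
    using assms
    by (auto simp: viewpoints_def trivial_limit_def eventually_inf_principal intro: le_infI1)
  show "?G \<le> F"
    by simp
  show "\<forall>\<^sub>F i in ?G. \<not> P i"
    by (simp add: eventually_inf_principal)
qed

lemma viewpoint_not_eventually_contradictory:
  assumes "G \<in> viewpoints" and "eventually P G" and "\<forall>\<^sub>F i in G. \<not> P i"
  shows False
  using eventually_conj[OF assms(2,3)] assms(1)
  by (simp add: viewpoints_def trivial_limit_def)

lemma viewpoints_never_eventually_iff:
  assumes "F \<in> viewpoints"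
  shows "(\<forall>G\<in>viewpoints. G \<le> F \<longrightarrow> \<not> eventually P G) \<longleftrightarrow> (\<forall>\<^sub>F i in F. \<not> P i)"
proof
  assume never: "\<forall>G\<in>viewpoints. G \<le> F \<longrightarrow> \<not> eventually P G"
  show "\<forall>\<^sub>F i in F. \<not> P i"
  proof (rule ccontr)
    assume "\<not> (\<forall>\<^sub>F i in F. \<not> P i)"
    then obtain G where "G \<in> viewpoints" "G \<le> F" "\<forall>\<^sub>F i in G. \<not> \<not> P i"
      by (rule viewpoint_refuting[OF assms])
    with never show False
      by simp
  qed
next
  assume "\<forall>\<^sub>F i in F. \<not> P i"
  then show "\<forall>G\<in>viewpoints. G \<le> F \<longrightarrow> \<not> eventually P G"
    by (blast dest: filter_leD viewpoint_not_eventually_contradictory)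
qed

lemma viewpoints_eventually_imp_iff:
  assumes "F \<in> viewpoints"
  shows "(\<forall>G\<in>viewpoints. G \<le> F \<longrightarrow> eventually P G \<longrightarrow> eventually Q G)
    \<longleftrightarrow> (\<forall>\<^sub>F i in F. P i \<longrightarrow> Q i)"
proof
  assume imp: "\<forall>G\<in>viewpoints. G \<le> F \<longrightarrow> eventually P G \<longrightarrow> eventually Q G"
  show "\<forall>\<^sub>F i in F. P i \<longrightarrow> Q i"
  proof (rule ccontr)
    assume "\<not> (\<forall>\<^sub>F i in F. P i \<longrightarrow> Q i)"
    then obtain G where G: "G \<in> viewpoints" "G \<le> F" "\<forall>\<^sub>F i in G. \<not> (P i \<longrightarrow> Q i)"
      by (rule viewpoint_refuting[OF assms])
    then have "eventually P G" "\<forall>\<^sub>F i in G. \<not> Q i"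
      by (auto elim: eventually_mono)
    with imp G viewpoint_not_eventually_contradictory show False
      by blast
  qed
next
  assume "\<forall>\<^sub>F i in F. P i \<longrightarrow> Q i"
  then show "\<forall>G\<in>viewpoints. G \<le> F \<longrightarrow> eventually P G \<longrightarrow> eventually Q G"
    by (blast dest: filter_leD intro: eventually_mp)
qed

text \<open>
  Membership in a filter is a local property of viewpoints: it can be verified on a dense set of
  extensions, since a viewpoint refuting \<open>P\<close> has no extension containing \<open>P\<close>. The forcing clauses
  for disjunction and existence only ask for truth on a dense set.
\<close>

lemma viewpoints_dense_eventually_iff:
  assumes "F \<in> viewpoints"
  shows "(\<forall>G\<in>viewpoints. G \<le> F \<longrightarrow> (\<exists>H\<in>viewpoints. H \<le> G \<and> eventually P H))
    \<longleftrightarrow> eventually P F"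
proof
  assume dense: "\<forall>G\<in>viewpoints. G \<le> F \<longrightarrow> (\<exists>H\<in>viewpoints. H \<le> G \<and> eventually P H)"
  show "eventually P F"
  proof (rule ccontr)
    assume "\<not> eventually P F"
    then obtain G where G: "G \<in> viewpoints" "G \<le> F" "\<forall>\<^sub>F i in G. \<not> P i"
      by (rule viewpoint_refuting[OF assms])
    with dense obtain H where H: "H \<in> viewpoints" "H \<le> G" "eventually P H"
      by blast
    from G(3) H(2) have "\<forall>\<^sub>F i in H. \<not> P i"
      by (rule filter_leD[rotated])
    with H show False
      by (blast intro: viewpoint_not_eventually_contradictory)
  qed
next
  assume "eventually P F"
  then show "\<forall>G\<in>viewpoints. G \<le> F \<longrightarrow> (\<exists>H\<in>viewpoints. H \<le> G \<and> eventually P H)"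
    by (blast dest: filter_leD)
qed

text \<open>
  A viewpoint that contains \<open>P \<or> Q\<close> need not contain either disjunct, but if it omits \<open>P\<close> then an
  extension refuting \<open>P\<close> contains \<open>Q\<close>.
\<close>

lemma viewpoint_deciding_disjunct:
  assumes "G \<in> viewpoints" and "\<forall>\<^sub>F i in G. P i \<or> Q i"
  shows "\<exists>H\<in>viewpoints. H \<le> G \<and> (eventually P H \<or> eventually Q H)"
proof (cases "eventually P G")
  case True
  with assms(1) show ?thesis
    by blast
next
  case False
  with assms(1) obtain H where H: "H \<in> viewpoints" "H \<le> G" "\<forall>\<^sub>F i in H. \<not> P i"
    by (rule viewpoint_refuting)
  from H(2) assms(2) have "\<forall>\<^sub>F i in H. P i \<or> Q i"
    by (rule filter_leD)
  with H(3) have "eventually Q H"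
    by eventually_elim blast
  with H show ?thesis
    by blast
qed

lemma viewpoints_dense_disj_iff:
  assumes "F \<in> viewpoints"
  shows "(\<forall>G\<in>viewpoints. G \<le> F \<longrightarrow> (\<exists>H\<in>viewpoints. H \<le> G \<and> (eventually P H \<or> eventually Q H)))
    \<longleftrightarrow> (\<forall>\<^sub>F i in F. P i \<or> Q i)" (is "?dense \<longleftrightarrow> ?ev")
proof
  assume ?dense
  moreover have "\<forall>\<^sub>F i in H. P i \<or> Q i" if "eventually P H \<or> eventually Q H" for H
    using that by (auto elim: eventually_mono)
  ultimately show ?ev
    unfolding viewpoints_dense_eventually_iff[OF assms, symmetric] by meson
next
  assume ?ev
  then show ?dense
    by (blast dest: filter_leD intro: viewpoint_deciding_disjunct)
qed

section \<open>Coordinatewise choice\<close>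

text \<open>
  In the first lemma below, \<open>b i\<close> is a counterexample at
  coordinate \<open>i\<close> whenever one exists; in the second it is a witness.
\<close>

lemma all_sequences_eventually_iff:
  "(\<forall>b. \<forall>\<^sub>F i in F. P i (b i)) \<longleftrightarrow> (\<forall>\<^sub>F i in F. \<forall>r. P i r)"
proof
  assume "\<forall>b. \<forall>\<^sub>F i in F. P i (b i)"
  then have "\<forall>\<^sub>F i in F. P i (SOME r. \<not> P i r)"
    by (rule spec)
  then show "\<forall>\<^sub>F i in F. \<forall>r. P i r"
    by (rule eventually_mono) (metis someI)
qed (auto elim: eventually_mono)

lemma ex_sequence_eventually_iff:
  "(\<exists>b. \<forall>\<^sub>F i in F. P i (b i)) \<longleftrightarrow> (\<forall>\<^sub>F i in F. \<exists>r. P i r)"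
proof
  assume "\<forall>\<^sub>F i in F. \<exists>r. P i r"
  then have "\<forall>\<^sub>F i in F. P i (SOME r. P i r)"
    by (rule eventually_mono) (rule someI_ex)
  then show "\<exists>b. \<forall>\<^sub>F i in F. P i (b i)"
    by (rule exI[of _ "\<lambda>i. SOME r. P i r"])
qed (auto elim: eventually_mono)

section \<open>Forcing as coordinatewise truth\<close>

text \<open>
  Classical satisfaction in \<open>\<real>\<close>, expanded by the predicates \<open>A\<^sub>i\<close>. The coordinate enters only
  through the clause for internal predicates.
\<close>

primrec holds_at :: "nat \<Rightarrow> fm \<Rightarrow> (nat \<Rightarrow> real) \<Rightarrow> bool" where
  "holds_at i (Eq s t) e \<longleftrightarrow> tm_val e s = tm_val e t"
| "holds_at i (Rel n R ts) e \<longleftrightarrow> map (tm_val e) ts \<in> R"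
| "holds_at i (Internal A t) e \<longleftrightarrow> tm_val e t \<in> A i"
| "holds_at i (Neg p) e \<longleftrightarrow> \<not> holds_at i p e"
| "holds_at i (Conj p q) e \<longleftrightarrow> holds_at i p e \<and> holds_at i q e"
| "holds_at i (Disj p q) e \<longleftrightarrow> holds_at i p e \<or> holds_at i q e"
| "holds_at i (Imp p q) e \<longleftrightarrow> (holds_at i p e \<longrightarrow> holds_at i q e)"
| "holds_at i (All v p) e \<longleftrightarrow> (\<forall>r. holds_at i p (e(v := r)))"
| "holds_at i (Ex v p) e \<longleftrightarrow> (\<exists>r. holds_at i p (e(v := r)))"

lemma coordinate_of_update: "(\<lambda>u. (e(v := b)) u i) = (\<lambda>u. e u i)(v := b i)"
  by auto

text \<open>
  The Los-type theorem. The filter varies in the induction because the clauses of forcing pass to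
  extensions of \<open>F\<close>; in each case the induction hypothesis turns the clause into a statement about
  membership in filters only.
\<close>

lemma forces_iff_eventually_holds_at:
  assumes "F \<in> viewpoints"
  shows "forces p F e \<longleftrightarrow> (\<forall>\<^sub>F i in F. holds_at i p (\<lambda>v. e v i))"
  using assms
proof (induction p arbitrary: F e)
  case (Eq s t)
  show ?case
    by (simp add: hval_def)
next
  case (Rel n R ts)
  show ?case
    by (simp add: hval_def)
next
  case (Internal A t)
  show ?case
    by (simp add: hval_def)
next
  case (Neg p)
  then show ?case
    by (simp add: viewpoints_never_eventually_iff)
next
  case (Conj p q)
  then show ?case
    by (simp add: eventually_conj_iff)
next
  case (Disj p q)
  then show ?case
    by (simp add: viewpoints_dense_disj_iff cong: conj_cong)
next
  case (Imp p q)
  then show ?case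
    by (simp add: viewpoints_eventually_imp_iff)
next
  case (All v p)
  then show ?case
    by (simp add: coordinate_of_update all_sequences_eventually_iff
          [where P = "\<lambda>i r. holds_at i p ((\<lambda>u. e u i)(v := r))"] del: fun_upd_apply)
next
  case (Ex v p)
  then show ?case
    by (simp add: coordinate_of_update ex_sequence_eventually_iff
          [where P = "\<lambda>i r. holds_at i p ((\<lambda>u. e u i)(v := r))"]
          viewpoints_dense_eventually_iff del: fun_upd_apply cong: conj_cong)
qed

section \<open>Sets defined by formulas\<close>

text \<open>
  Freshness of \<open>y\<close> and equal lengths ensure that \<open>y\<close> is sent to the last entry \<open>b\<close>: otherwise an
  earlier occurrence of \<open>y\<close> would shadow it, or the two lists would be out of step.
\<close>

lemma assign_snoc:
  assumes "length xs = length as" and "y \<notin> set xs"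
  shows "assign (xs @ [y]) (as @ [b]) = (assign xs as)(y := b)"
proof
  fix v
  have "map_of (zip xs as) y = None"
    using assms by simp
  then show "assign (xs @ [y]) (as @ [b]) v = ((assign xs as)(y := b)) v"
    using assms(1) by (simp add: assign_def map_add_def del: map_of_zip_is_None split: option.split)
qed

theorem theorem3p12:
  fixes \<phi> :: fm and n :: nat and xs :: "nat list" and y :: nat
    and as :: "hyper list" and F :: "nat filter"
  assumes "is_formula \<phi>"
    and "length xs = n" and "distinct (xs @ [y])"
    and "free_vars \<phi> \<subseteq> set (xs @ [y])"
    and "length as = n"
    and "F \<in> viewpoints"
  shows "internal_in F {b. forces \<phi> F (assign (xs @ [y]) (as @ [b]))}"
proof -
  let ?e = "assign xs as"
  let ?A = "\<lambda>i. {r. holds_at i \<phi> ((\<lambda>v. ?e v i)(y := r))}"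
  have "forces \<phi> F (assign (xs @ [y]) (as @ [b])) \<longleftrightarrow> (\<forall>\<^sub>F i in F. b i \<in> ?A i)" for b
  proof -
    have "assign (xs @ [y]) (as @ [b]) = ?e(y := b)"
      using assms by (intro assign_snoc) auto
    then show ?thesis
      using assms(6)
      by (simp add: forces_iff_eventually_holds_at coordinate_of_update del: fun_upd_apply)
  qed
  then have "{b. forces \<phi> F (assign (xs @ [y]) (as @ [b]))} = internal_ext F ?A"
    by (simp add: internal_ext_def)
  then show ?thesis
    unfolding internal_in_def by blast
qed

end
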